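(* Assume that $f$ and $\ell$ are continuous, that $\mathbb{X}\times\mathbb{U}$ is compact, and that $\mathbb{U}^N(x)$ is nonempty for all $x\in\mathbb{X}$ and $N\in\mathbb{N}$. Then for all $x\in\mathbb{X}$ and all $N\in\mathbb{N}$ the finite-horizon Cesàro value function satisfies $$\bar V^{\mathrm{ces}}_N(x)=\min_{u\in\mathbb{U}^1(x)}\Big(\bar\ell(x,u)+\frac{N-1}{N}\,\bar V^{\mathrm{ces}}_{N-1}(f(x,u))\Big),$$ where for $N=1$ the second term is understood to be $0$ (i.e. $\bar V^{\mathrm{ces}}_0:=0$).
   Context: $\mathbb{N}=\{1,2,\dots\}$. Discrete-time system $x(k+1)=f(x(k),u(k))$ with constraint sets $\mathbb{X}\subset\mathbb{R}^n$, $\mathbb{U}\subset\mathbb{R}^m$, $f:\mathbb{X}\times\mathbb{U}\to\mathbb{R}^n$, and stage cost $\ell:\mathbb{X}\times\mathbb{U}\to\mathbb{R}$. For $x\in\mathbb{X}$ and an input sequence $u$, $x_u(0,x)=x$ and $x_u(k+1,x)=f(x_u(k,x),u(k))$. $\mathbb{U}^N(x)$ is the set of $u\in\mathbb{U}^N$ such that $x_u(k,x)\in\mathbb{X}$ for all integers $0\le k\le N$; in particular $\mathbb{U}^1(x)=\{u\in\mathbb{U}: f(x,u)\in\mathbb{X}\}$. $\mathbb{U}^\infty(x)$ is the set of infinite input sequences in $\mathbb{U}$ with $x_u(k,x)\in\mathbb{X}$ for all $k\ge0$. The optimal asymptotic average performance is $\ell^\star=\inf_{u\in\mathbb{U}^\infty(x)}\liminf_{N\to\infty}\frac1N\sum_{k=0}^{N-1}\ell(x_u(k,x),u(k))$,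 assumed to be a constant independent of $x$; the shifted stage cost is $\bar\ell=\ell-\ell^\star$. The Cesàro cost is $\bar J^{\mathrm{ces}}_N(x,u)=\frac1N\sum_{n=0}^{N-1}\sum_{k=0}^{n}\bar\ell(x_u(k,x),u(k))$ and the finite-horizon Cesàro value function is $\bar V^{\mathrm{ces}}_N(x)=\inf_{u\in\mathbb{U}^N(x)}\bar J^{\mathrm{ces}}_N(x,u)$. *)

theory Defs imports "HOL-Analysis.Analysis"
begin

primrec traj :: "(('x \<times> 'u) \<Rightarrow> 'x) \<Rightarrow> (nat \<Rightarrow> 'u) \<Rightarrow> nat \<Rightarrow> 'x \<Rightarrow> 'x" where
  "traj f u 0 x = x"
| "traj f u (Suc k) x = f (traj f u k x, u k)"

(* A finite input sequence of length N is an extensional function on {..<N}. *)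
definition admissible ::
    "'x set \<Rightarrow> 'u set \<Rightarrow> (('x \<times> 'u) \<Rightarrow> 'x) \<Rightarrow> nat \<Rightarrow> 'x \<Rightarrow> (nat \<Rightarrow> 'u) set" where
  "admissible X U f N x = {u \<in> {..<N} \<rightarrow>\<^sub>E U. \<forall>k\<le>N. traj f u k x \<in> X}"

definition admissible_inf ::
    "'x set \<Rightarrow> 'u set \<Rightarrow> (('x \<times> 'u) \<Rightarrow> 'x) \<Rightarrow> 'x \<Rightarrow> (nat \<Rightarrow> 'u) set" where
  "admissible_inf X U f x = {u. (\<forall>k. u k \<in> U) \<and> (\<forall>k. traj f u k x \<in> X)}"

(* Sequences of length one, identified with their single entry;
   see one_step_inputs_eq_admissible. *)
definition one_step_inputs :: "'x set \<Rightarrow> 'u set \<Rightarrow> (('x \<times> 'u) \<Rightarrow> 'x) \<Rightarrow> 'x \<Rightarrow> 'u set" where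
  "one_step_inputs X U f x = {u \<in> U. f (x, u) \<in> X}"

lemma one_step_inputs_eq_admissible:
  assumes "x \<in> X"
  shows "one_step_inputs X U f x = (\<lambda>u. u 0) ` admissible X U f 1 x"
proof (intro equalityI subsetI)
  fix v assume v: "v \<in> one_step_inputs X U f x"
  have "(\<lambda>i. if i = (0::nat) then v else undefined) \<in> admissible X U f 1 x"
    using v assms
    by (auto simp: admissible_def one_step_inputs_def PiE_def extensional_def le_Suc_eq)
  then show "v \<in> (\<lambda>u. u 0) ` admissible X U f 1 x"
    by (rule rev_image_eqI) simp
next
  fix v assume "v \<in> (\<lambda>u. u 0) ` admissible X U f 1 x"
  then show "v \<in> one_step_inputs X U f x"
    by (auto simp: admissible_def one_step_inputs_def PiE_def Pi_def le_Suc_eq all_conj_distrib)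
qed

(* Taken in the extended reals, where liminf and infimum always exist. *)
definition opt_avg_cost ::
    "'x set \<Rightarrow> 'u set \<Rightarrow> (('x \<times> 'u) \<Rightarrow> 'x) \<Rightarrow> (('x \<times> 'u) \<Rightarrow> real) \<Rightarrow> 'x \<Rightarrow> ereal" where
  "opt_avg_cost X U f l x =
     (INF u\<in>admissible_inf X U f x.
        liminf (\<lambda>N. ereal (1 / real N * (\<Sum>k<N. l (traj f u k x, u k)))))"

definition shifted_cost :: "('z \<Rightarrow> real) \<Rightarrow> real \<Rightarrow> 'z \<Rightarrow> real" where
  "shifted_cost l lstar z = l z - lstar"

definition ces_cost ::
    "(('x \<times> 'u) \<Rightarrow> 'x) \<Rightarrow> (('x \<times> 'u) \<Rightarrow> real) \<Rightarrow> real \<Rightarrow> nat \<Rightarrow> 'x \<Rightarrow> (nat \<Rightarrow> 'u) \<Rightarrow> real" where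
  "ces_cost f l lstar N x u =
     1 / real N * (\<Sum>n<N. \<Sum>k\<le>n. shifted_cost l lstar (traj f u k x, u k))"

(* The real infimum is the true one whenever admissible X U f N x is nonempty and l is
   bounded below on X \<times> U, as for continuous l and compact X \<times> U. *)
definition ces_value ::
    "'x set \<Rightarrow> 'u set \<Rightarrow> (('x \<times> 'u) \<Rightarrow> 'x) \<Rightarrow> (('x \<times> 'u) \<Rightarrow> real) \<Rightarrow> real \<Rightarrow> nat \<Rightarrow> 'x \<Rightarrow> real" where
  "ces_value X U f l lstar N x =
     (if N = 0 then 0 else (INF u\<in>admissible X U f N x. ces_cost f l lstar N x u))"

definition is_minimum_on :: "real \<Rightarrow> ('a \<Rightarrow> real) \<Rightarrow> 'a set \<Rightarrow> bool" where
  "is_minimum_on m g A \<longleftrightarrow> (\<exists>a\<in>A. g a = m) \<and> (\<forall>a\<in>A. m \<le> g a)"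

end

theory Submission imports Defs
begin

text \<open>Splitting an input sequence into its first entry and its tail turns the Cesaro cost of horizon
  \<open>N + 1\<close> into the stage cost of the first step plus \<open>N / (N + 1)\<close> times the Cesaro cost of horizon
  \<open>N\<close> from the successor state. By compactness in the product topology every value is attained,
  so minimizers at both horizons can be split and prolonged.\<close>

lemma compact_PiE_UNIV:
  fixes S :: "'i \<Rightarrow> ('a::topological_space) set"
  assumes "\<And>i. compact (S i)"
  shows "compact (PiE UNIV S)"
  using assms compactin_PiE[of "\<lambda>_. euclidean" UNIV S]
  by (simp add: euclidean_product_topology)

text \<open>Extensionality becomes a singleton factor at each index from \<open>N\<close> on. This
  presents the finite sequences as a product over all of \<open>nat\<close>, the form to which
  Tychonoff's theorem applies.\<close>

lemma PiE_lessThan_eq_PiE_UNIV: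
  fixes N :: nat
  shows "{..<N} \<rightarrow>\<^sub>E U = (\<Pi>\<^sub>E i\<in>UNIV. if i < N then U else {undefined})"
  by (auto simp: PiE_def Pi_def extensional_def split: if_splits)

text \<open>Compactness and continuity feed each other. As \<open>f\<close> is continuous only on
  \<open>X \<times> U\<close>, continuity of the state at time \<open>j + 1\<close> is obtained on
  sequences that keep the state in \<open>X\<close> up to time \<open>j\<close>; this continuity in
  turn makes the constraint at time \<open>j + 1\<close> a closed one. Hence a joint induction on
  \<open>j\<close>, with the horizon \<open>N\<close> fixed.\<close>

lemma compact_admissible_prefix:
  fixes X :: "('x::t2_space) set" and U :: "('u::t2_space) set" and x :: 'x
  assumes f: "continuous_on (X \<times> U) f" and X: "compact X" and U: "compact U"
    and "j \<le> N"
  defines "B \<equiv> \<lambda>j. {u \<in> {..<N} \<rightarrow>\<^sub>E U. \<forall>k\<le>j. traj f u k x \<in> X}"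
  shows "compact (B j) \<and> continuous_on (B j) (\<lambda>u. traj f u j x)"
  using \<open>j \<le> N\<close>
proof (induction j)
  case 0
  have "compact ({..<N} \<rightarrow>\<^sub>E U)"
    using U by (auto simp: PiE_lessThan_eq_PiE_UNIV intro!: compact_PiE_UNIV)
  moreover have "B 0 = (if x \<in> X then {..<N} \<rightarrow>\<^sub>E U else {})"
    by (auto simp: B_def)
  ultimately show ?case
    by simp
next
  case (Suc j)
  then have IH: "compact (B j)" "continuous_on (B j) (\<lambda>u. traj f u j x)" and "j < N"
    by auto
  have "continuous_on (B j) (\<lambda>u. (traj f u j x, u j))"
    by (intro continuous_on_Pair IH continuous_on_product_coordinates
        continuous_on_subset[OF continuous_on_product_coordinates]) auto
  moreover have "(\<lambda>u. (traj f u j x, u j)) ` B j \<subseteq> X \<times> U"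
    using \<open>j < N\<close> by (auto simp: B_def)
  ultimately have cont: "continuous_on (B j) (\<lambda>u. traj f u (Suc j) x)"
    using continuous_on_compose2[OF f] by simp
  have eq: "B (Suc j) = B j \<inter> (\<lambda>u. traj f u (Suc j) x) -` X"
    by (auto simp: B_def le_Suc_eq simp del: traj.simps)
  \<comment> \<open>The map is continuous on \<open>B j\<close> only, so the preimage of
    \<open>X\<close> is closed relative to \<open>B j\<close>; this is enough because
    \<open>B j\<close> is compact.\<close>
  have "closedin (top_of_set (B j)) (B (Suc j))"
    unfolding eq by (intro continuous_closedin_preimage cont compact_imp_closed X)
  then have "compact (B (Suc j))"
    using IH(1) closedin_compact by blast
  moreover have "continuous_on (B (Suc j)) (\<lambda>u. traj f u (Suc j) x)"
    using cont by (rule continuous_on_subset) (use eq in blast)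
  ultimately show ?case by blast
qed

lemma compact_admissible:
  fixes X :: "('x::t2_space) set" and U :: "('u::t2_space) set"
  assumes "continuous_on (X \<times> U) f" "compact X" "compact U"
  shows "compact (admissible X U f N x)"
  using compact_admissible_prefix[OF assms order_refl] unfolding admissible_def by blast

lemma continuous_on_admissible_traj:
  fixes X :: "('x::t2_space) set" and U :: "('u::t2_space) set"
  assumes "continuous_on (X \<times> U) f" "compact X" "compact U" "k \<le> N"
  shows "continuous_on (admissible X U f N x) (\<lambda>u. traj f u k x)"
  using conjunct2[OF compact_admissible_prefix[OF assms]]
  by (rule continuous_on_subset) (use assms(4) in \<open>auto simp: admissible_def\<close>)

lemma continuous_on_ces_cost:
  fixes X :: "('x::t2_space) set" and U :: "('u::t2_space) set"
  assumes f: "continuous_on (X \<times> U) f" and l: "continuous_on (X \<times> U) l"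
    and "compact X" "compact U"
  shows "continuous_on (admissible X U f N x) (ces_cost f l lstar N x)"
proof -
  have "continuous_on (admissible X U f N x) (\<lambda>u. l (traj f u k x, u k))" if "k < N" for k
  proof (rule continuous_on_compose2[OF l])
    show "continuous_on (admissible X U f N x) (\<lambda>u. (traj f u k x, u k))"
      using assms that
      by (intro continuous_on_Pair continuous_on_admissible_traj
          continuous_on_subset[OF continuous_on_product_coordinates]) auto
    show "(\<lambda>u. (traj f u k x, u k)) ` admissible X U f N x \<subseteq> X \<times> U"
      using that by (auto simp: admissible_def)
  qed
  then show ?thesis
    unfolding ces_cost_def[abs_def] shifted_cost_def
    by (intro continuous_on_mult continuous_on_const continuous_on_sum continuous_on_diff) auto
qed

lemma admissible_0: "admissible X U f 0 x = (if x \<in> X then {\<lambda>_. undefined} else {})"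
  by (auto simp: admissible_def)

lemma ces_value_is_minimum:
  fixes X :: "('x::t2_space) set" and U :: "('u::t2_space) set"
  assumes "continuous_on (X \<times> U) f" "continuous_on (X \<times> U) l" "compact X" "compact U"
    and ne: "admissible X U f N x \<noteq> {}"
  shows "is_minimum_on (ces_value X U f l lstar N x) (ces_cost f l lstar N x)
    (admissible X U f N x)"
proof -
  obtain u where u: "u \<in> admissible X U f N x"
    and min: "\<forall>v\<in>admissible X U f N x. ces_cost f l lstar N x u \<le> ces_cost f l lstar N x v"
    using continuous_attains_inf[OF compact_admissible ne continuous_on_ces_cost] assms by metis
  have "(INF v\<in>admissible X U f N x. ces_cost f l lstar N x v) = ces_cost f l lstar N x u"
    using u min by (intro cInf_eq_minimum) auto
  \<comment> \<open>At horizon 0 the value is 0 by convention, and so is the cost, an empty sum. The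
    two conventions agree, so horizon 0 can be treated like any other.\<close>
  moreover have "ces_cost f l lstar 0 x u = 0"
    by (simp add: ces_cost_def)
  ultimately have "ces_value X U f l lstar N x = ces_cost f l lstar N x u"
    by (auto simp: ces_value_def)
  then show ?thesis
    using u min by (auto simp: is_minimum_on_def)
qed

lemma traj_case_nat: "traj f (case_nat a v) (Suc k) x = traj f v k (f (x, a))"
  by (induction k) auto

text \<open>\<open>case_nat a v\<close> prepends \<open>a\<close> to \<open>v\<close>. The shift by
  one moves the start of the \<open>undefined\<close> tail from \<open>N\<close> to
  \<open>Suc N\<close>, so extensionality transfers in both directions.\<close>

lemma admissible_case_nat:
  "case_nat a v \<in> admissible X U f (Suc N) x \<longleftrightarrow>
    x \<in> X \<and> a \<in> U \<and> v \<in> admissible X U f N (f (x, a))"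
proof -
  have all_nat: "(\<forall>i. P i) \<longleftrightarrow> P 0 \<and> (\<forall>i. P (Suc i))" for P
    by (metis nat.exhaust)
  have "case_nat a v \<in> {..<Suc N} \<rightarrow>\<^sub>E U \<longleftrightarrow> a \<in> U \<and> v \<in> {..<N} \<rightarrow>\<^sub>E U"
    by (simp add: PiE_lessThan_eq_PiE_UNIV PiE_UNIV_domain Pi_iff all_nat[of "\<lambda>i. case_nat a v i \<in> _ i"])
  moreover have "(\<forall>k\<le>Suc N. traj f (case_nat a v) k x \<in> X) \<longleftrightarrow>
      x \<in> X \<and> (\<forall>k\<le>N. traj f v k (f (x, a)) \<in> X)"
    unfolding atMost_iff[symmetric] Ball_def[symmetric] atMost_Suc_eq_insert_0
    by (simp add: traj_case_nat del: traj.simps(2))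
  ultimately show ?thesis
    by (auto simp: admissible_def)
qed

text \<open>The first stage cost occurs in each of the \<open>Suc N\<close> inner sums, so averaging
  gives it weight one. What remains is the double sum of the tail, whose normalization changes from
  \<open>N\<close> to \<open>Suc N\<close>.\<close>

lemma ces_cost_case_nat:
  "ces_cost f l lstar (Suc N) x (case_nat a v) =
    shifted_cost l lstar (x, a) + real N / real (Suc N) * ces_cost f l lstar N (f (x, a)) v"
proof -
  define c where "c k = shifted_cost l lstar (traj f v k (f (x, a)), v k)" for k
  define d where "d k = shifted_cost l lstar (traj f (case_nat a v) k x, case_nat a v k)" for k
  have d: "d 0 = shifted_cost l lstar (x, a)" "d (Suc k) = c k" for k
    by (simp_all add: c_def d_def traj_case_nat del: traj.simps(2))
  have "(\<Sum>n<Suc N. \<Sum>k\<le>n. d k) = (\<Sum>n<Suc N. d 0 + (\<Sum>k<n. c k))"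
    by (simp only: lessThan_Suc_atMost[symmetric] sum.lessThan_Suc_shift d)
  \<comment> \<open>The inner sum over \<open>k<n\<close> is empty for \<open>n = 0\<close>;
    dropping it and shifting \<open>n\<close> turns \<open>k<n\<close> into
    \<open>k\<le>n\<close>.\<close>
  also have "\<dots> = real (Suc N) * d 0 + (\<Sum>n<N. \<Sum>k\<le>n. c k)"
    by (simp only: sum.distrib sum_constant card_lessThan sum.lessThan_Suc_shift
        lessThan_Suc_atMost[symmetric]) simp
  finally show ?thesis
    unfolding ces_cost_def c_def[symmetric] d_def[symmetric] d(1)[symmetric]
    by (cases "N = 0") (simp_all add: add_divide_distrib)
qed

theorem theorem8:
  fixes X :: "(real ^ 'n) set" and U :: "(real ^ 'm) set"
    and f :: "(real ^ 'n) \<times> (real ^ 'm) \<Rightarrow> real ^ 'n"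
    and l :: "(real ^ 'n) \<times> (real ^ 'm) \<Rightarrow> real"
    and lstar :: real
  assumes "continuous_on (X \<times> U) f"
    and "continuous_on (X \<times> U) l"
    and "compact (X \<times> U)"
    and "\<forall>x\<in>X. \<forall>N\<ge>1. admissible X U f N x \<noteq> {}"
    and "\<forall>x\<in>X. opt_avg_cost X U f l x = ereal lstar"
  shows "\<forall>x\<in>X. \<forall>N\<ge>1.
    is_minimum_on (ces_value X U f l lstar N x)
      (\<lambda>u. shifted_cost l lstar (x, u)
            + (real N - 1) / real N * ces_value X U f l lstar (N - 1) (f (x, u)))
      (one_step_inputs X U f x)"
proof (intro ballI allI impI)
  fix x and N :: nat
  assume "x \<in> X" and "1 \<le> N"
  then obtain M where N: "N = Suc M"
    by (cases N) auto
  \<comment> \<open>Horizon 0 is included because the tail problem has horizon \<open>M\<close>,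
    which is 0 when \<open>N = 1\<close>.\<close>
  have ne: "admissible X U f K y \<noteq> {}" if "y \<in> X" for K y
    using assms(4) that by (cases "K = 0") (auto simp: admissible_0)
  \<comment> \<open>With both factors nonempty, \<open>X\<close> and \<open>U\<close> are the
    projections of the compact set \<open>X \<times> U\<close>.\<close>
  obtain u\<^sub>0 where "u\<^sub>0 \<in> U"
    using ne[OF \<open>x \<in> X\<close>, of 1] by (auto simp: admissible_def)
  have XU: "compact X" "compact U"
  proof -
    have "X = fst ` (X \<times> U)" "U = snd ` (X \<times> U)"
      using \<open>x \<in> X\<close> \<open>u\<^sub>0 \<in> U\<close> by force+
    then show "compact X" "compact U"
      using assms(3) compact_continuous_image[OF continuous_on_fst[OF continuous_on_id], of "X \<times> U"]
        compact_continuous_image[OF continuous_on_snd[OF continuous_on_id], of "X \<times> U"]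
      by simp_all
  qed
  let ?J = "ces_cost f l lstar" and ?V = "ces_value X U f l lstar"
  let ?g = "\<lambda>u. shifted_cost l lstar (x, u) + real M / real (Suc M) * ?V M (f (x, u))"
  have V: "is_minimum_on (?V K y) (?J K y) (admissible X U f K y)" if "y \<in> X" for K y
    using assms(1,2) XU ne[OF that] by (rule ces_value_is_minimum)
  \<comment> \<open>Prepending \<open>a\<close> to an optimal sequence from the successor state
    gives an admissible competitor at horizon \<open>N\<close> whose cost is exactly
    \<open>?g a\<close>.\<close>
  have upper: "?V N x \<le> ?g a" if a: "a \<in> one_step_inputs X U f x" for a
  proof -
    obtain v where "v \<in> admissible X U f M (f (x, a))" "?J M (f (x, a)) v = ?V M (f (x, a))"
      using V a by (fastforce simp: is_minimum_on_def one_step_inputs_def)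
    moreover from this have "case_nat a v \<in> admissible X U f N x"
      using \<open>x \<in> X\<close> a by (simp add: N admissible_case_nat one_step_inputs_def)
    ultimately show ?thesis
      using V[OF \<open>x \<in> X\<close>, of N] ces_cost_case_nat[of f l lstar M x a v]
      by (metis N is_minimum_on_def)
  qed
  \<comment> \<open>Conversely, the first entry of an optimal sequence at horizon \<open>N\<close>
    attains the minimum: its tail costs at least the value at the successor state, which gives the
    inequality opposite to \<open>upper\<close>.\<close>
  obtain w where w: "w \<in> admissible X U f N x" "?J N x w = ?V N x"
    using V[OF \<open>x \<in> X\<close>, of N] by (auto simp: is_minimum_on_def)
  define a v where "a = w 0" and "v = w \<circ> Suc"
  have "w = case_nat a v"
    by (auto simp: a_def v_def fun_eq_iff split: nat.splits)
  with w have av: "a \<in> U" "v \<in> admissible X U f M (f (x, a))"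
    and J: "?V N x = shifted_cost l lstar (x, a) + real M / real (Suc M) * ?J M (f (x, a)) v"
    by (auto simp: N admissible_case_nat ces_cost_case_nat)
  have fX: "f (x, a) \<in> X"
    using av(2) by (auto simp: admissible_def dest: spec[of _ 0])
  then have a: "a \<in> one_step_inputs X U f x"
    using av(1) by (simp add: one_step_inputs_def)
  have "?V M (f (x, a)) \<le> ?J M (f (x, a)) v"
    using V[OF fX] av(2) by (auto simp: is_minimum_on_def)
  then have "?g a \<le> ?V N x"
    unfolding J by (intro add_left_mono mult_left_mono) auto
  with upper a have "is_minimum_on (?V N x) ?g (one_step_inputs X U f x)"
    by (auto simp: is_minimum_on_def intro!: bexI[of _ a] antisym)
  then show "is_minimum_on (?V N x) (\<lambda>u. shifted_cost l lstar (x, u)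
      + (real N - 1) / real N * ?V (N - 1) (f (x, u))) (one_step_inputs X U f x)"
    by (simp add: N)
qed

end
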